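(* If $T\in \mathcal{F}$ has order $n$ and leaf order $\ell$, then $\iota (T)=\frac {n+\ell}{4}$. Moreover, $T$ has a minimum isolating set formed by all the vertices in $A$ and one vertex labeled $x$ from each copy of the path of order $4$ used in the construction of $T$.
   Context: Graphs are finite and simple. A leaf is a vertex of degree $1$; the leaf order is the number of leaves; the order is the number of vertices. For $D\subseteq V(G)$, $N[D]$ is the set consisting of the vertices of $D$ and all their neighbours. An isolating set of $G$ is a set $D\subseteq V(G)$ such that $G-N[D]$ has no edges. The isolation number $\iota(G)$ is the size of a smallest isolating set, and an isolating set of size $\iota(G)$ is called a minimum isolating set. The family $\mathcal{F}$ of trees: Consider copies of a path of order $3$ with one leaf labeled $a$, the other leaf labeled $c$ and the vertex of degree $2$ labeled $b$, and copies of a path of order $4$ with the two leaves labeled $x$ and the two vertices of degree $2$ labeled $y$, all copies being pairwise vertex-disjoint. Let $A,B,C,X,Y$ be the sets of vertices of these copies labeled $a,b,c,x,y$, respectively. A tree $T$ belongs to $\mathcal{F}$ if and only if $T$ can be obtained from $r\ge 2$ copies of the path of order $3$ and $s\ge 0$ copies of the path of order $4$ by adding edges with endpoints in $A\cup X$ so that no vertex in $A\cup X$ remains a leaf in $T$ (that is, the leaves of $T$ are the vertices in $C$). *)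

theory Defs
  imports "Graph_Theory.Digraph_Component" Complex_Main
begin

text \<open>
  A finite simple graph is a \<^locale>\<open>pair_graph\<close>: a finite loop-free symmetric digraph whose arcs
  are pairs of vertices. The edge $uv$ is represented by the two arcs $(u,v)$ and $(v,u)$, so the
  degree of a vertex is its out-degree.
\<close>

text \<open>
  The constant \<^const>\<open>tree\<close> of the library excludes directed cycles of every positive length, and
  hence also the closed walk $u, v, u$ along the two arcs of a single edge. An undirected cycle has
  length at least 3.
\<close>

definition undirected_tree :: "'a pair_pre_digraph \<Rightarrow> bool" where
  "undirected_tree G \<longleftrightarrow> pair_graph G \<and> connected G \<and>
     \<not> (\<exists>p. pre_digraph.cycle G p \<and> 3 \<le> length p)"

definition leaves :: "'a pair_pre_digraph \<Rightarrow> 'a set" where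
  "leaves G = {v \<in> pverts G. out_degree G v = 1}"

definition closed_neighbourhood :: "'a pair_pre_digraph \<Rightarrow> 'a set \<Rightarrow> 'a set" where
  "closed_neighbourhood G D = D \<union> {v. \<exists>u \<in> D. u \<rightarrow>\<^bsub>G\<^esub> v}"

definition isolating_set :: "'a pair_pre_digraph \<Rightarrow> 'a set \<Rightarrow> bool" where
  "isolating_set G D \<longleftrightarrow> D \<subseteq> pverts G \<and>
     arcs (G \<restriction> (pverts G - closed_neighbourhood G D)) = {}"

definition isolation_number :: "'a pair_pre_digraph \<Rightarrow> nat" where
  "isolation_number G = Min (card ` {D. isolating_set G D})"

definition minimum_isolating_set :: "'a pair_pre_digraph \<Rightarrow> 'a set \<Rightarrow> bool" where
  "minimum_isolating_set G D \<longleftrightarrow> isolating_set G D \<and> card D = isolation_number G"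

text \<open>
  A path is given by the list of its vertices in order. A labelled copy of the path of order 3 is a
  list $[a,b,c]$, and a labelled copy of the path of order 4 is a list $[x,y,y',x']$.
\<close>

definition path_arcs :: "'a list \<Rightarrow> ('a \<times> 'a) set" where
  "path_arcs p = set (zip p (tl p)) \<union> (set (zip p (tl p)))\<inverse>"

definition A_set :: "'a list list \<Rightarrow> 'a set" where
  "A_set ps = {p ! 0 | p. p \<in> set ps}"

definition X_set :: "'a list list \<Rightarrow> 'a set" where
  "X_set qs = (\<Union>q \<in> set qs. {q ! 0, q ! 3})"

text \<open>
  The list \<open>ps\<close> consists of the $r$ copies of the path of order 3 and \<open>qs\<close> of the $s$ copies of the
  path of order 4; distinctness of the concatenation says that each copy has distinct vertices and
  that the copies are pairwise vertex-disjoint. The relation \<open>F\<close> is the set of added edges.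
\<close>

definition F_construction ::
    "'a pair_pre_digraph \<Rightarrow> 'a list list \<Rightarrow> 'a list list \<Rightarrow> bool" where
  "F_construction T ps qs \<longleftrightarrow>
     undirected_tree T \<and>
     2 \<le> length ps \<and> (\<forall>p \<in> set ps. length p = 3) \<and> (\<forall>q \<in> set qs. length q = 4) \<and>
     distinct (concat (ps @ qs)) \<and>
     pverts T = set (concat (ps @ qs)) \<and>
     (\<exists>F. F \<subseteq> (A_set ps \<union> X_set qs) \<times> (A_set ps \<union> X_set qs) \<and> sym F \<and>
          parcs T = (\<Union>p \<in> set (ps @ qs). path_arcs p) \<union> F) \<and>
     (A_set ps \<union> X_set qs) \<inter> leaves T = {}"

definition family_F :: "'a pair_pre_digraph set" where
  "family_F = {T. \<exists>ps qs. F_construction T ps qs}"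

end

theory Submission
  imports Defs
begin

text \<open>
  Let $T$ be built from $r$ paths $abc$ and $s$ paths $xyy'x'$. Both $n + \ell = 4(r+s)$ and
  $\iota(T) = r+s$ rest on one observation: a vertex outside $A \cup X$ keeps exactly the neighbours
  that it has in its own copy, since added edges have both ends in $A \cup X$. So the leaves are
  the vertices in $C$, and $n = 3r+4s$, $\ell = r$.

  Lower bound (\<open>isolating_set_card_ge\<close>). Each copy has an edge between two vertices outside
  $A \cup X$, namely $bc$ or $yy'$. The closed neighbourhoods of its ends lie in the copy, so
  an isolating set must contain a vertex of the copy, and the copies are disjoint.

  Upper bound (\<open>end_choice_dominates_ends\<close> and \<open>ends_dominated_imp_isolating\<close>). Direct all edges
  of the tree away from a root, so that every vertex has at most one parent. In a copy $xyy'x'$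
  choose $x$ if $x$ is the parent of $y$, and $x'$ otherwise. The end that is not chosen has its
  neighbour within the path as its parent. It is not a leaf, so it has another neighbour $w$, which is
  therefore its child and which lies in $A \cup X$. If $w$ belongs to another path of order 4, then
  $w$ is entered from outside its path, hence is the parent of its neighbour $y$ within that path,
  and this makes $w$ the chosen end there. So every vertex of $A \cup X$ is dominated by $A$ together
  with the chosen ends, and what remains is a set of isolated vertices: those in $C$ and at most one
  $y$ from each path of order 4.
\<close>

section \<open>Orienting a tree away from a root\<close>

text \<open>
  A path of length at least 2 closed up by an arc is a cycle of length at least 3. Length 1 is
  the harmless case of the two arcs of a single edge.
\<close>

lemma tree_no_closing_arc:
  assumes tree: "undirected_tree T"
    and path: "pre_digraph.apath T v p u"
    and arc: "(u, v) \<in> parcs T"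
  shows "length p \<le> 1"
proof (rule ccontr)
  assume "\<not> length p \<le> 1"
  interpret pair_graph T
    using tree by (simp add: undirected_tree_def)
  have walk: "awalk v p u" and dist: "distinct (awalk_verts v p)"
    using path by (auto simp: apath_def)
  have closing: "awalk u [(u, v)] v"
    using arc by (simp add: awalk_simps in_arcsD2)
  have "awalk v (p @ [(u, v)]) v"
    using walk closing by auto
  then have "awalk u ((u, v) # p) u"
    using walk arc by (simp add: awalk_Cons_iff)
  moreover have "distinct (tl (awalk_verts u ((u, v) # p)))"
    using dist by simp
  ultimately have "cycle ((u, v) # p)"
    unfolding cycle_def by blast
  moreover have "3 \<le> length ((u, v) # p)"
    using \<open>\<not> length p \<le> 1\<close> by simp
  ultimately show False
    using tree unfolding undirected_tree_def by blast
qed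

text \<open>
  Otherwise the walk from $u$ to $w$ shortens to a path that still avoids $v$, and prepending the
  edge $vu$ gives a path from $v$ to $w$ of length at least 2, closed by the edge $wv$.
\<close>

lemma tree_no_two_arcs_into_walk:
  assumes tree: "undirected_tree T"
    and walk: "pre_digraph.awalk T u p w"
    and avoid: "v \<notin> set (pre_digraph.awalk_verts T u p)"
    and arcs: "(u, v) \<in> parcs T" "(w, v) \<in> parcs T"
  shows "u = w"
proof (rule ccontr)
  assume "u \<noteq> w"
  interpret pair_graph T
    using tree by (simp add: undirected_tree_def)
  define q where "q = awalk_to_apath p"
  have q: "apath u q w"
    using walk unfolding q_def by (rule apath_awalk_to_apath)
  then have wq: "awalk u q w"
    by (rule awalkI_apath)
  have "set q \<subseteq> set p"
    using walk unfolding q_def by (rule awalk_to_apath_subset)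
  then have "set (awalk_verts u q) \<subseteq> set (awalk_verts u p)"
    using set_awalk_verts[OF wq] set_awalk_verts[OF walk] by auto
  then have "v \<notin> set (awalk_verts u q)"
    using avoid by (auto simp: awalk_verts_with_proj_eq)
  then have "apath v ((v, u) # q) w"
    using q arcs_symmetric[OF arcs(1)] by (simp add: apath_Cons_iff)
  then have "length ((v, u) # q) \<le> 1"
    using tree_no_closing_arc[OF tree] arcs(2) by blast
  then have "q = []" by simp
  with q \<open>u \<noteq> w\<close> show False
    by (simp add: apath_Nil_iff)
qed

text \<open>
  The relation \<open>parent u v\<close> says that the edge $uv$ points away from a root. Every
  edge does so in one of its directions because the path from the root to one end either avoids the
  other end or uses the edge last; two parents of one vertex would lie on a cycle with it.
\<close>

lemma tree_orientation:
  assumes tree: "undirected_tree T"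
  obtains parent :: "'a \<Rightarrow> 'a \<Rightarrow> bool" where
    "\<And>u v. (u, v) \<in> parcs T \<Longrightarrow> parent u v \<or> parent v u"
    "\<And>u w v. parent u v \<Longrightarrow> parent w v \<Longrightarrow> u = w"
proof -
  interpret pair_graph T
    using tree by (simp add: undirected_tree_def)
  have conn: "strongly_connected (mk_symmetric T)"
    using tree by (simp add: undirected_tree_def connected_def)
  then obtain r where r: "r \<in> pverts T"
    by (auto simp: strongly_connected_def)
  have path_from_root: "\<exists>p. apath r p u" if "u \<in> pverts T" for u
  proof -
    have "r \<rightarrow>\<^sup>*\<^bsub>mk_symmetric T\<^esub> u"
      using conn r that by (auto simp: strongly_connected_def)
    then have "r \<rightarrow>\<^sup>*\<^bsub>T\<^esub> u"
      using reachable_mk_symmetric_eq sym_arcs by blast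
    then show ?thesis
      by (simp add: reachable_apath)
  qed
  \<comment> \<open>The edge $uv$ points away from \<open>r\<close> when \<open>u\<close> can be reached without passing through \<open>v\<close>.\<close>
  define parent where "parent u v \<longleftrightarrow>
    (u, v) \<in> parcs T \<and> (\<exists>p. awalk r p u \<and> v \<notin> set (awalk_verts r p))" for u v
  have "parent u v \<or> parent v u" if uv: "(u, v) \<in> parcs T" for u v
  proof -
    obtain p where p: "apath r p u"
      using path_from_root in_arcsD1[OF uv] by blast
    then have wp: "awalk r p u" by (rule awalkI_apath)
    show ?thesis
    proof (cases "v \<in> set (awalk_verts r p)")
      case False
      with uv wp show ?thesis unfolding parent_def by blast
    next
      case True
      \<comment> \<open>The part of the path after \<open>v\<close> has to be the edge $vu$ itself, so the part before avoids \<open>u\<close>.\<close>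
      then obtain p1 p2 where split: "p = p1 @ p2" "awalk r p1 v" "awalk v p2 u"
        using awalk_decomp[OF wp] by blast
      have last: "awlast r p1 = v"
        using split(2) by auto
      have "apath v p2 u" and disj: "set (awalk_verts r p1) \<inter> set (tl (awalk_verts v p2)) = {}"
        using p last unfolding split(1) by (auto simp: apath_append_iff)
      then have "length p2 \<le> 1"
        using tree_no_closing_arc[OF tree] uv by blast
      moreover have "u \<noteq> v" using uv no_loops' by blast
      then have "p2 \<noteq> []" using split(3) by (auto simp: awalk_Nil_iff)
      ultimately obtain e where "p2 = [e]"
        by (cases p2) auto
      then have "u \<in> set (tl (awalk_verts v p2))"
        using split(3) by (auto simp: awalk_simps)
      then have "u \<notin> set (awalk_verts r p1)"
        using disj by blast
      then show ?thesis
        using split(2) arcs_symmetric[OF uv] unfolding parent_def by blast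
    qed
  qed
  moreover have "u = w" if par: "parent u v" "parent w v" for u w v
  proof -
    obtain p q where p: "awalk r p u" "v \<notin> set (awalk_verts r p)"
      and q: "awalk r q w" "v \<notin> set (awalk_verts r q)"
      and arcs: "(u, v) \<in> parcs T" "(w, v) \<in> parcs T"
      using par unfolding parent_def by blast
    \<comment> \<open>Walking from \<open>u\<close> back to the root and on to \<open>w\<close> never meets \<open>v\<close>.\<close>
    have rp: "awalk u (rev_path p) r"
      using p(1) by simp
    then have walk: "awalk u (rev_path p @ q) w"
      using q(1) by (rule awalk_appendI)
    have "set (awalk_verts u (rev_path p @ q)) = set (awalk_verts r p) \<union> set (awalk_verts r q)"
      using set_awalk_verts_append[OF rp q(1)] awalk_verts_rev_path[OF p(1)] by simp
    then have "v \<notin> set (awalk_verts u (rev_path p @ q))"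
      using p(2) q(2) by simp
    then show ?thesis
      using tree_no_two_arcs_into_walk[OF tree walk _ arcs] by (simp add: awalk_verts_with_proj_eq)
  qed
  ultimately show thesis by (rule that)
qed

section \<open>Copies and their inner vertices\<close>

locale F_tree =
  fixes T :: "'a pair_pre_digraph" and ps qs :: "'a list list"
  assumes construction: "F_construction T ps qs"
begin

definition copies :: "'a list set" where
  "copies = set (ps @ qs)"

lemma tree: "undirected_tree T"
  using construction by (simp add: F_construction_def)

lemma arcs_sym: "(u, v) \<in> parcs T \<Longrightarrow> (v, u) \<in> parcs T"
proof -
  interpret pair_graph T
    using tree by (simp add: undirected_tree_def)
  show "(u, v) \<in> parcs T \<Longrightarrow> (v, u) \<in> parcs T"
    by (rule arcs_symmetric)
qed

lemma distinct_concat_copies: "distinct (concat (ps @ qs))"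
  using construction by (simp add: F_construction_def)

lemma pverts_eq: "pverts T = set (concat (ps @ qs))"
  using construction by (simp add: F_construction_def)

lemma finite_pverts: "finite (pverts T)"
  by (simp add: pverts_eq)

lemma vertex_in_copy: "v \<in> pverts T \<longleftrightarrow> (\<exists>p \<in> copies. v \<in> set p)"
  by (auto simp: pverts_eq copies_def)

lemma copy3: "p \<in> set ps \<Longrightarrow> \<exists>a b c. p = [a, b, c]"
  using construction by (auto simp: F_construction_def length_Suc_conv numeral_3_eq_3)

lemma copy4: "q \<in> set qs \<Longrightarrow> \<exists>x y y' x'. q = [x, y, y', x']"
  using construction by (auto simp: F_construction_def length_Suc_conv eval_nat_numeral)

lemma copy_cases:
  assumes "p \<in> copies"
  obtains (path3) a b c where "p \<in> set ps" "p = [a, b, c]"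
    | (path4) x y y' x' where "p \<in> set qs" "p = [x, y, y', x']"
proof (cases "p \<in> set ps")
  case True
  then show thesis using copy3 path3 by blast
next
  case False
  then have "p \<in> set qs" using assms by (simp add: copies_def)
  then show thesis using copy4 path4 by blast
qed

lemma copy_distinct: "p \<in> copies \<Longrightarrow> distinct p"
  using distinct_concat_copies unfolding distinct_concat_iff copies_def by blast

lemma copies_disjoint:
  "p \<in> copies \<Longrightarrow> p' \<in> copies \<Longrightarrow> v \<in> set p \<Longrightarrow> v \<in> set p' \<Longrightarrow> p = p'"
  using distinct_concat_copies unfolding distinct_concat_iff copies_def by blast

lemma distinct_copies: "distinct (ps @ qs)"
proof -
  have "[] \<notin> set (ps @ qs)"
    using construction by (auto simp: F_construction_def)
  then show ?thesis
    using distinct_concat_copies unfolding distinct_concat_iff by (metis removeAll_id)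
qed

lemma card_copies: "card copies = length ps + length qs"
  using distinct_card[OF distinct_copies] by (simp add: copies_def)

lemma card_pverts: "card (pverts T) = 3 * length ps + 4 * length qs"
proof -
  have "card (pverts T) = sum_list (map length (ps @ qs))"
    unfolding pverts_eq distinct_card[OF distinct_concat_copies] by (rule length_concat)
  also have "map length (ps @ qs) = map (\<lambda>_. 3) ps @ map (\<lambda>_. 4) qs"
    using construction by (simp add: F_construction_def)
  finally show ?thesis
    by (simp add: sum_list_triv)
qed

text \<open>
  The sets $A$ and $X$ are defined through all copies at once; disjointness brings membership in
  them back to the position of the vertex in its own copy.
\<close>

lemma end_vertex_position:
  assumes "p \<in> copies" "v \<in> set p" "v \<in> A_set ps \<union> X_set qs"
  shows "v = p ! 0 \<or> p \<in> set qs \<and> v = p ! 3"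
proof -
  obtain p' where p': "p' \<in> copies" "v \<in> set p'" "v = p' ! 0 \<or> p' \<in> set qs \<and> v = p' ! 3"
  proof (cases "v \<in> A_set ps")
    case True
    then obtain p' where "p' \<in> set ps" "v = p' ! 0"
      by (auto simp: A_set_def)
    with copy3[OF this(1)] show thesis
      by (intro that[of p']) (auto simp: copies_def)
  next
    case False
    then obtain q where "q \<in> set qs" "v = q ! 0 \<or> v = q ! 3"
      using assms(3) by (auto simp: X_set_def)
    with copy4[OF this(1)] show thesis
      by (intro that[of q]) (auto simp: copies_def)
  qed
  with copies_disjoint assms(1,2) have "p' = p" by blast
  with p' show ?thesis by blast
qed

lemma parcs_decomposition:
  "\<exists>F. F \<subseteq> (A_set ps \<union> X_set qs) \<times> (A_set ps \<union> X_set qs) \<and> sym F \<and>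
    parcs T = (\<Union>p \<in> copies. path_arcs p) \<union> F"
  using construction unfolding F_construction_def copies_def by (elim conjE)

lemma arc_cases:
  assumes "(v, w) \<in> parcs T"
  shows "(\<exists>p \<in> copies. (v, w) \<in> path_arcs p) \<or>
    v \<in> A_set ps \<union> X_set qs \<and> w \<in> A_set ps \<union> X_set qs"
  using parcs_decomposition assms by (elim exE conjE) auto

lemma path_arcs_in_arcs: "p \<in> copies \<Longrightarrow> path_arcs p \<subseteq> parcs T"
  using parcs_decomposition by (elim exE conjE) auto

lemma path_arcs_in_copy: "(v, w) \<in> path_arcs p \<Longrightarrow> v \<in> set p \<and> w \<in> set p"
  unfolding path_arcs_def by (cases p) (auto dest: set_zip_leftD set_zip_rightD)

text \<open>
  A vertex outside $A \cup X$ is incident with no added edge.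
\<close>

lemma inner_vertex_arcs:
  assumes "p \<in> copies" "v \<in> set p" "v \<notin> A_set ps \<union> X_set qs"
  shows "(v, w) \<in> parcs T \<longleftrightarrow> (v, w) \<in> path_arcs p"
proof
  assume "(v, w) \<in> parcs T"
  then obtain p' where p': "p' \<in> copies" "(v, w) \<in> path_arcs p'"
    using arc_cases assms(3) by blast
  then have "p' = p"
    using copies_disjoint assms(1,2) path_arcs_in_copy by metis
  then show "(v, w) \<in> path_arcs p"
    using p'(2) by simp
next
  assume "(v, w) \<in> path_arcs p"
  then show "(v, w) \<in> parcs T"
    using path_arcs_in_arcs[OF assms(1)] by blast
qed

lemma inner_arcs_path3:
  assumes "[a, b, c] \<in> set ps"
  shows "(b, w) \<in> parcs T \<longleftrightarrow> w = a \<or> w = c"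
    and "(c, w) \<in> parcs T \<longleftrightarrow> w = b"
proof -
  have p: "[a, b, c] \<in> copies" "[a, b, c] \<notin> set qs"
    using assms copy4[of "[a, b, c]"] by (auto simp: copies_def)
  then have d: "distinct [a, b, c]"
    using copy_distinct by blast
  have inner: "b \<notin> A_set ps \<union> X_set qs" "c \<notin> A_set ps \<union> X_set qs"
    using end_vertex_position[OF p(1), of b] end_vertex_position[OF p(1), of c] p(2) d by auto
  have arcs: "path_arcs [a, b, c] = {(a, b), (b, c), (b, a), (c, b)}"
    unfolding path_arcs_def by auto
  show "(b, w) \<in> parcs T \<longleftrightarrow> w = a \<or> w = c"
    using inner_vertex_arcs[OF p(1) _ inner(1)] d by (auto simp: arcs)
  show "(c, w) \<in> parcs T \<longleftrightarrow> w = b"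
    using inner_vertex_arcs[OF p(1) _ inner(2)] d by (auto simp: arcs)
qed

lemma inner_arcs_path4:
  assumes "[x, y, y', x'] \<in> set qs"
  shows "(y, w) \<in> parcs T \<longleftrightarrow> w = x \<or> w = y'"
    and "(y', w) \<in> parcs T \<longleftrightarrow> w = y \<or> w = x'"
proof -
  have q: "[x, y, y', x'] \<in> copies"
    using assms by (simp add: copies_def)
  then have d: "distinct [x, y, y', x']"
    using copy_distinct by blast
  have inner: "y \<notin> A_set ps \<union> X_set qs" "y' \<notin> A_set ps \<union> X_set qs"
    using end_vertex_position[OF q, of y] end_vertex_position[OF q, of y'] d by auto
  have arcs: "path_arcs [x, y, y', x'] = {(x, y), (y, y'), (y', x'), (y, x), (y', y), (x', y')}"
    unfolding path_arcs_def by auto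
  show "(y, w) \<in> parcs T \<longleftrightarrow> w = x \<or> w = y'"
    using inner_vertex_arcs[OF q _ inner(1)] d by (auto simp: arcs)
  show "(y', w) \<in> parcs T \<longleftrightarrow> w = y \<or> w = x'"
    using inner_vertex_arcs[OF q _ inner(2)] d by (auto simp: arcs)
qed

section \<open>The leaves\<close>

lemma out_degree_eq: "out_degree T v = card {w. (v, w) \<in> parcs T}"
proof -
  have "out_arcs T v = Pair v ` {w. (v, w) \<in> parcs T}"
    by (auto simp: out_arcs_def)
  then show ?thesis
    by (simp add: out_degree_def card_image inj_on_def)
qed

lemma leaves_eq: "leaves T = (\<lambda>p. p ! 2) ` set ps"
proof
  show "(\<lambda>p. p ! 2) ` set ps \<subseteq> leaves T"
  proof
    fix v assume "v \<in> (\<lambda>p. p ! 2) ` set ps"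
    then obtain a b where p: "[a, b, v] \<in> set ps"
      using copy3 by fastforce
    then have "v \<in> pverts T"
      unfolding vertex_in_copy copies_def by (intro bexI[of _ "[a, b, v]"]) auto
    moreover have "out_degree T v = 1"
      using inner_arcs_path3(2)[OF p] by (simp add: out_degree_eq)
    ultimately show "v \<in> leaves T"
      by (simp add: leaves_def)
  qed
next
  show "leaves T \<subseteq> (\<lambda>p. p ! 2) ` set ps"
  proof
    fix v assume v: "v \<in> leaves T"
    then have deg: "card {w. (v, w) \<in> parcs T} = 1" and not_end: "v \<notin> A_set ps \<union> X_set qs"
      using construction by (auto simp: leaves_def out_degree_eq F_construction_def)
    obtain p where p: "p \<in> copies" "v \<in> set p"
      using v vertex_in_copy by (auto simp: leaves_def)
    have d: "distinct p" using p(1) by (rule copy_distinct)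
    from p(1) show "v \<in> (\<lambda>p. p ! 2) ` set ps"
    proof (cases rule: copy_cases)
      case (path3 a b c)
      have "{w. (b, w) \<in> parcs T} = {a, c}"
        using inner_arcs_path3(1) path3 by blast
      then have "v \<noteq> b" using deg d path3(2) by auto
      moreover have "v \<noteq> a" using not_end path3 by (force simp: A_set_def)
      ultimately have "v = p ! 2" using p(2) path3(2) by simp
      then show ?thesis using path3(1) by blast
    next
      case (path4 x y y' x')
      have "{w. (y, w) \<in> parcs T} = {x, y'}" "{w. (y', w) \<in> parcs T} = {y, x'}"
        using inner_arcs_path4 path4 by blast+
      then have "v \<noteq> y" "v \<noteq> y'" using deg d path4(2) by auto
      moreover have "v \<noteq> x" "v \<noteq> x'" using not_end path4 by (force simp: X_set_def)+
      ultimately show ?thesis using p(2) path4(2) by simp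
    qed
  qed
qed

lemma card_leaves: "card (leaves T) = length ps"
proof -
  have "inj_on (\<lambda>p. p ! 2) (set ps)"
  proof (rule inj_onI)
    fix p p' assume p: "p \<in> set ps" "p' \<in> set ps" "p ! 2 = p' ! 2"
    then have "p ! 2 \<in> set p" "p ! 2 \<in> set p'"
      using copy3 by fastforce+
    with p show "p = p'"
      using copies_disjoint by (auto simp: copies_def)
  qed
  then show ?thesis
    using distinct_copies by (simp add: leaves_eq card_image distinct_card)
qed

section \<open>The isolation number\<close>

lemma isolating_set_iff:
  "isolating_set T D \<longleftrightarrow> D \<subseteq> pverts T \<and>
    (\<forall>u v. (u, v) \<in> parcs T \<longrightarrow> u \<in> closed_neighbourhood T D \<or> v \<in> closed_neighbourhood T D)"
proof -
  have "u \<in> pverts T \<and> v \<in> pverts T" if "(u, v) \<in> parcs T" for u v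
  proof -
    interpret pair_graph T
      using tree by (simp add: undirected_tree_def)
    show ?thesis using that in_arcsD1 in_arcsD2 by blast
  qed
  then show ?thesis
    unfolding isolating_set_def by fastforce
qed

text \<open>
  The edge $bc$, respectively $yy'$, must have an end in the closed neighbourhood of \<open>D\<close>, and all
  neighbours of both ends lie in the copy.
\<close>

lemma isolating_set_meets_copy:
  assumes D: "isolating_set T D" and p: "p \<in> copies"
  shows "D \<inter> set p \<noteq> {}"
proof -
  have edge: "u \<in> closed_neighbourhood T D \<or> v \<in> closed_neighbourhood T D"
    if "(u, v) \<in> parcs T" for u v
    using D that by (simp add: isolating_set_iff)
  have closed: "D \<inter> insert v {w. (v, w) \<in> parcs T} \<noteq> {}"
    if "v \<in> closed_neighbourhood T D" for v
    using that arcs_sym by (auto simp: closed_neighbourhood_def)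
  from p show ?thesis
  proof (cases rule: copy_cases)
    case (path3 a b c)
    note nb = inner_arcs_path3[OF path3(1)[unfolded path3(2)]]
    have "(b, c) \<in> parcs T" by (simp add: nb)
    then show ?thesis
      using edge[of b c] closed[of b] closed[of c] unfolding path3(2) nb by auto
  next
    case (path4 x y y' x')
    note nb = inner_arcs_path4[OF path4(1)[unfolded path4(2)]]
    have "(y, y') \<in> parcs T" by (simp add: nb)
    then show ?thesis
      using edge[of y y'] closed[of y] closed[of y'] unfolding path4(2) nb by auto
  qed
qed

lemma isolating_set_card_ge:
  assumes D: "isolating_set T D"
  shows "length ps + length qs \<le> card D"
proof -
  have "\<forall>p \<in> copies. \<exists>v. v \<in> D \<inter> set p"
    using isolating_set_meets_copy[OF D] by blast
  then obtain g where g: "\<forall>p \<in> copies. g p \<in> D \<inter> set p"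
    by (rule bchoice[THEN exE])
  have "inj_on g copies"
    by (rule inj_onI) (metis IntD2 copies_disjoint g)
  moreover have "g ` copies \<subseteq> D" using g by blast
  moreover have "finite D"
    using D finite_pverts by (auto simp: isolating_set_def intro: finite_subset)
  ultimately show ?thesis
    using card_inj_on_le card_copies by metis
qed

lemma end_vertex_extra_arc:
  assumes end_v: "v \<in> A_set ps \<union> X_set qs" and arc: "(v, u) \<in> parcs T"
  shows "\<exists>w. (v, w) \<in> parcs T \<and> w \<noteq> u"
proof (rule ccontr)
  assume "\<not> ?thesis"
  then have "{w. (v, w) \<in> parcs T} = {u}" using arc by blast
  then have "out_degree T v = 1" by (simp add: out_degree_eq)
  moreover have "v \<in> pverts T"
  proof -
    interpret pair_graph T
      using tree by (simp add: undirected_tree_def)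
    show ?thesis using arc in_arcsD1 by blast
  qed
  ultimately have "v \<in> leaves T" by (simp add: leaves_def)
  with end_v show False
    using construction by (auto simp: F_construction_def)
qed

text \<open>
  In each path of order 4 the chosen end is the one at which the orientation enters the path; if it
  enters at neither end, both edges at the ends point outwards and the choice is arbitrary. The end
  that is not chosen is dominated by one of its children.
\<close>

lemma end_choice_dominates_ends:
  "\<exists>f. (\<forall>q \<in> set qs. f q \<in> {q ! 0, q ! 3}) \<and>
    (\<forall>v \<in> X_set qs. v \<in> closed_neighbourhood T (A_set ps \<union> f ` set qs))"
proof -
  obtain parent :: "'a \<Rightarrow> 'a \<Rightarrow> bool" where
    orient: "\<And>u v. (u, v) \<in> parcs T \<Longrightarrow> parent u v \<or> parent v u" and
    unique: "\<And>u w v. parent u v \<Longrightarrow> parent w v \<Longrightarrow> u = w"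
    using tree_orientation[OF tree] by blast
  define f where "f q = (if parent (q ! 0) (q ! 1) then q ! 0 else q ! 3)" for q
  define D where "D = A_set ps \<union> f ` set qs"
  \<comment> \<open>A child outside the copy of its parent lies in $A$ or is the end at which its own path is entered.\<close>
  have child_in_D: "w \<in> D"
    if v: "q \<in> set qs" "v \<in> set q" and w: "w \<in> A_set ps \<union> X_set qs" "parent v w" "w \<notin> set q" for q v w
  proof (cases "w \<in> A_set ps")
    case True
    then show ?thesis by (simp add: D_def)
  next
    case False
    then obtain q' where q': "q' \<in> set qs" "w = q' ! 0 \<or> w = q' ! 3"
      using w(1) by (auto simp: X_set_def)
    obtain x y y' x' where q'_eq: "q' = [x, y, y', x']"
      using copy4 q'(1) by blast
    note nb = inner_arcs_path4[OF q'(1)[unfolded q'_eq]]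
    have "q' \<noteq> q" using w(3) q'(2) unfolding q'_eq by auto
    then have v_notin: "v \<notin> set q'"
      using copies_disjoint v q'(1) by (auto simp: copies_def)
    have d: "distinct [x, y, y', x']"
      using copy_distinct[of q'] q'(1) unfolding q'_eq by (simp add: copies_def)
    have "w = f q'"
    proof (cases "w = x")
      case True
      then have "\<not> parent y x"
        using unique[of v w y] w(2) v_notin q'_eq by auto
      then have "parent x y" using orient[of y x] nb by blast
      then show ?thesis using True by (simp add: f_def q'_eq)
    next
      case False
      then have wx': "w = x'" using q'(2) by (simp add: q'_eq)
      \<comment> \<open>From the entry at \<open>x\'\<close> the orientation runs along the whole path towards \<open>x\<close>.\<close>
      then have "\<not> parent y' x'"
        using unique[of v w y'] w(2) v_notin q'_eq by auto
      then have "parent x' y'" using orient[of y' x'] nb by blast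
      then have "\<not> parent y y'" using unique[of x' y' y] d by auto
      then have "parent y' y" using orient[of y y'] nb by blast
      then have "\<not> parent x y" using unique[of y' y x] d by auto
      then show ?thesis using wx' by (simp add: f_def q'_eq)
    qed
    then show ?thesis using q'(1) by (auto simp: D_def)
  qed
  \<comment> \<open>Here \<open>v\<close> is the end that is not chosen and \<open>u\<close>, its neighbour within the path, is its parent.\<close>
  have far_end: "v \<in> closed_neighbourhood T D"
    if q: "q \<in> set qs" "q = [x, y, y', x']" and par: "parent u v"
      and pos: "v = x' \<and> u = y' \<and> f q = x \<or> v = x \<and> u = y \<and> f q = x'"
    for q v u x y y' x'
  proof -
    have q_copy: "q \<in> copies" and v_q: "v \<in> set q"
      using q pos by (auto simp: copies_def)
    have v_end: "v \<in> A_set ps \<union> X_set qs"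
      using q pos by (force simp: X_set_def)
    have "(u, v) \<in> parcs T"
      using inner_arcs_path4[OF q(1)[unfolded q(2)]] pos by auto
    then obtain w where w: "(v, w) \<in> parcs T" "w \<noteq> u"
      using end_vertex_extra_arc[OF v_end] arcs_sym by blast
    then have par_w: "parent v w"
      using orient[of v w] unique[OF par] by blast
    have "v \<noteq> w" using par par_w unique w(2) by blast
    have w_end: "w \<in> A_set ps \<union> X_set qs"
    proof (rule ccontr)
      assume "w \<notin> A_set ps \<union> X_set qs"
      then obtain p where p: "p \<in> copies" "(v, w) \<in> path_arcs p"
        using arc_cases[OF w(1)] by blast
      then have "p = q"
        using copies_disjoint q_copy v_q path_arcs_in_copy by metis
      then show False
        using p(2) copy_distinct[OF q_copy] pos w(2) unfolding q(2) by (auto simp: path_arcs_def)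
    qed
    have "w \<in> D"
    proof (cases "w \<in> set q")
      case True
      then have "w = f q"
        \<comment> \<open>An added edge joining the two ends of one path would lead straight to the chosen end.\<close>
        using end_vertex_position[OF q_copy True w_end] \<open>v \<noteq> w\<close> pos unfolding q(2) by auto
      then show ?thesis using q(1) by (simp add: D_def)
    next
      case False
      then show ?thesis using child_in_D[OF q(1) v_q w_end par_w] by blast
    qed
    then show ?thesis
      using arcs_sym[OF w(1)] by (auto simp: closed_neighbourhood_def)
  qed
  have "v \<in> closed_neighbourhood T D" if v: "v \<in> X_set qs" for v
  proof -
    obtain q where q: "q \<in> set qs" "v = q ! 0 \<or> v = q ! 3"
      using v by (auto simp: X_set_def)
    obtain x y y' x' where q_eq: "q = [x, y, y', x']"
      using copy4 q(1) by blast
    note nb = inner_arcs_path4[OF q(1)[unfolded q_eq]]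
    have d: "distinct [x, y, y', x']"
      using copy_distinct[of q] q(1) unfolding q_eq by (simp add: copies_def)
    have chosen: "f q \<in> closed_neighbourhood T D"
      using q(1) by (simp add: closed_neighbourhood_def D_def)
    show ?thesis
    proof (cases "parent x y")
      case True
      then have fq: "f q = x" by (simp add: f_def q_eq)
      have "\<not> parent y' y" using unique[OF True, of y'] d by auto
      then have "parent y y'" using orient[of y y'] nb by blast
      then have "\<not> parent x' y'" using unique[of y y' x'] d by auto
      then have "parent y' x'" using orient[of y' x'] nb by blast
      then have "x' \<in> closed_neighbourhood T D"
        using far_end[OF q(1) q_eq, of y' x'] fq by blast
      then show ?thesis
        using chosen fq q(2) by (auto simp: q_eq)
    next
      case False
      then have fq: "f q = x'" and "parent y x"
        using orient[of y x] nb by (auto simp: f_def q_eq)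
      then have "x \<in> closed_neighbourhood T D"
        using far_end[OF q(1) q_eq, of y x] by blast
      then show ?thesis
        using chosen fq q(2) by (auto simp: q_eq)
    qed
  qed
  moreover have "\<forall>q \<in> set qs. f q \<in> {q ! 0, q ! 3}"
    by (simp add: f_def)
  ultimately show ?thesis
    unfolding D_def by blast
qed

text \<open>
  Added edges join vertices of $A \cup X$, which are all dominated. In a path $abc$ the vertex $a$
  dominates $b$, an end of both edges. In a path $xyy'x'$ both ends are dominated and the chosen
  one dominates its neighbour, so $yy'$ is covered as well.
\<close>

lemma ends_dominated_imp_isolating:
  assumes f: "\<forall>q \<in> set qs. f q \<in> {q ! 0, q ! 3}"
    and dom: "\<forall>v \<in> X_set qs. v \<in> closed_neighbourhood T (A_set ps \<union> f ` set qs)"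
  shows "isolating_set T (A_set ps \<union> f ` set qs)"
proof -
  define D where "D = A_set ps \<union> f ` set qs"
  have ends: "v \<in> closed_neighbourhood T D" if "v \<in> A_set ps \<union> X_set qs" for v
    using that dom unfolding D_def by (auto simp: closed_neighbourhood_def)
  have nbr: "v \<in> closed_neighbourhood T D" if "u \<in> D" "(u, v) \<in> parcs T" for u v
    using that by (auto simp: closed_neighbourhood_def)
  have copy_arc: "u \<in> closed_neighbourhood T D \<or> v \<in> closed_neighbourhood T D"
    if p: "p \<in> copies" "(u, v) \<in> path_arcs p" for p u v
    using p(1)
  proof (cases rule: copy_cases)
    case (path3 a b c)
    have "p ! 0 \<in> A_set ps" using path3(1) by (auto simp: A_set_def)
    then have "a \<in> D" by (simp add: D_def path3(2))
    moreover have "(a, b) \<in> parcs T"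
      using inner_arcs_path3[OF path3(1)[unfolded path3(2)]] arcs_sym by blast
    ultimately have "b \<in> closed_neighbourhood T D" by (rule nbr)
    moreover have "u = b \<or> v = b" using p(2) path3(2) by (auto simp: path_arcs_def)
    ultimately show ?thesis by blast
  next
    case (path4 x y y' x')
    note nb = inner_arcs_path4[OF path4(1)[unfolded path4(2)]]
    have "p ! 0 \<in> X_set qs" "p ! 3 \<in> X_set qs"
      using path4(1) by (auto simp: X_set_def)
    then have "x \<in> closed_neighbourhood T D" "x' \<in> closed_neighbourhood T D"
      using ends by (simp_all add: path4(2))
    moreover have "y \<in> closed_neighbourhood T D \<or> y' \<in> closed_neighbourhood T D"
    proof -
      have "f p \<in> D" using path4(1) by (simp add: D_def)
      moreover have "f p = x \<or> f p = x'"
        using bspec[OF f path4(1)] by (simp add: path4(2))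
      moreover have "(x, y) \<in> parcs T" "(x', y') \<in> parcs T"
        using nb arcs_sym by blast+
      ultimately show ?thesis using nbr by metis
    qed
    ultimately show ?thesis using p(2) path4(2) by (auto simp: path_arcs_def)
  qed
  have "u \<in> closed_neighbourhood T D \<or> v \<in> closed_neighbourhood T D"
    if "(u, v) \<in> parcs T" for u v
    using arc_cases[OF that] copy_arc ends by metis
  moreover have "D \<subseteq> pverts T"
  proof
    fix v assume "v \<in> D"
    then consider p where "p \<in> set ps" "v = p ! 0" | q where "q \<in> set qs" "v = q ! 0 \<or> v = q ! 3"
      using f by (fastforce simp: D_def A_set_def)
    then show "v \<in> pverts T"
    proof cases
      case 1
      with copy3[OF 1(1)] show ?thesis
        unfolding vertex_in_copy by (intro bexI[of _ p]) (auto simp: copies_def)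
    next
      case 2
      with copy4[OF 2(1)] show ?thesis
        unfolding vertex_in_copy by (intro bexI[of _ q]) (auto simp: copies_def)
    qed
  qed
  ultimately show ?thesis
    by (simp add: isolating_set_iff D_def)
qed

lemma card_choice_le: "card (A_set ps \<union> f ` set qs) \<le> length ps + length qs"
proof -
  have "A_set ps = (\<lambda>p. p ! 0) ` set ps"
    by (auto simp: A_set_def)
  then have "card (A_set ps) \<le> length ps"
    using le_trans[OF card_image_le card_length] by simp
  moreover have "card (f ` set qs) \<le> length qs"
    by (rule le_trans[OF card_image_le card_length]) simp
  ultimately show ?thesis
    using card_Un_le[of "A_set ps" "f ` set qs"] by linarith
qed

lemma isolation_number_eq_and_minimum:
  "isolation_number T = length ps + length qs \<and>
    (\<exists>f. (\<forall>q \<in> set qs. f q \<in> {q ! 0, q ! 3}) \<and>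
      minimum_isolating_set T (A_set ps \<union> f ` set qs))"
proof -
  obtain f where f: "\<forall>q \<in> set qs. f q \<in> {q ! 0, q ! 3}"
    and iso: "isolating_set T (A_set ps \<union> f ` set qs)"
    using end_choice_dominates_ends ends_dominated_imp_isolating by blast
  have card: "card (A_set ps \<union> f ` set qs) = length ps + length qs"
    using isolating_set_card_ge[OF iso] card_choice_le[of f] by linarith
  have "{D. isolating_set T D} \<subseteq> Pow (pverts T)"
    by (auto simp: isolating_set_def)
  then have "finite {D. isolating_set T D}"
    using finite_pverts by (simp add: finite_subset)
  then have "isolation_number T = length ps + length qs"
    unfolding isolation_number_def using iso card isolating_set_card_ge
    by (intro Min_eqI) (auto simp: image_iff intro!: exI[of _ "A_set ps \<union> f ` set qs"])
  then show ?thesis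
    using f iso card by (auto simp: minimum_isolating_set_def)
qed

end

theorem proposition3p4:
  fixes T :: "'a pair_pre_digraph" and n l :: nat
  assumes "T \<in> family_F"
    and "n = card (pverts T)"
    and "l = card (leaves T)"
  shows "real (isolation_number T) = (real n + real l) / 4 \<and>
    (\<forall>ps qs. F_construction T ps qs \<longrightarrow>
       (\<exists>f. (\<forall>q \<in> set qs. f q \<in> {q ! 0, q ! 3}) \<and>
            minimum_isolating_set T (A_set ps \<union> f ` set qs)))"
proof -
  have eq: "isolation_number T = length ps + length qs \<and>
      (\<exists>f. (\<forall>q \<in> set qs. f q \<in> {q ! 0, q ! 3}) \<and>
        minimum_isolating_set T (A_set ps \<union> f ` set qs))"
    and count: "n + l = 4 * (length ps + length qs)"
    if c: "F_construction T ps qs" for ps qs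
  proof -
    interpret F_tree T ps qs using c by unfold_locales
    show "isolation_number T = length ps + length qs \<and>
      (\<exists>f. (\<forall>q \<in> set qs. f q \<in> {q ! 0, q ! 3}) \<and>
        minimum_isolating_set T (A_set ps \<union> f ` set qs))"
      by (rule isolation_number_eq_and_minimum)
    show "n + l = 4 * (length ps + length qs)"
      using assms(2,3) card_pverts card_leaves by simp
  qed
  obtain ps qs where c: "F_construction T ps qs"
    using assms(1) by (auto simp: family_F_def)
  have "n + l = 4 * isolation_number T"
    using eq[OF c] count[OF c] by simp
  then have "real n + real l = 4 * real (isolation_number T)"
    by (metis of_nat_add of_nat_mult of_nat_numeral)
  then show ?thesis using eq by simp
qed

end
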